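(* Let $n\ge 1$ and let $X_1,\ldots,X_n$ be independent real-valued random variables. Suppose there are real numbers $\mu$, $M$ and $\sigma>0$ such that for all $i=1,\ldots,n$, $\mathrm{E}[X_i]=\mu$, $\mathrm{E}[(X_i-\mu)^2]=\sigma^2$ and $\Pr(X_i\in(-\infty,M])=1$. Put $s=M-\mu$. Then for every $t\in(0,M-\mu)$, $$\Pr\left(\frac1n\sum_{i=1}^n X_i-\frac1n\sum_{i=1}^n \mathrm{E}[X_i]\ge t\right)\le e^{-\lambda n t}\left(\frac{\sigma^2}{s^2}\left(e^{\lambda s}-1-\lambda s\right)+1\right)^n,$$ where $$\lambda=\frac1t+\frac{s}{\sigma^2}-\frac1s-\frac1s\mathcal{W}\left(\exp\left(\frac st+\frac{s^2}{\sigma^2}-1+\ln\left(\frac{s-t}{t}\right)\right)\right).$$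
   Context: $\mathcal{W}$ denotes the principal branch of Lambert's function: for $y>0$, $\mathcal{W}(y)$ is the unique real $w>0$ with $w e^{w}=y$. *)

theory Defs
  imports "HOL-Probability.Probability"
begin

text \<open>
  The principal branch of Lambert's function, restricted to positive arguments; the value of
  \<open>lambert_W y\<close> is meaningful for \<open>y > 0\<close> only.
\<close>

definition lambert_W :: "real \<Rightarrow> real" where
  "lambert_W y = (THE w. 0 < w \<and> w * exp w = y)"

lemma lambert_W_ex1:
  fixes y :: real
  assumes "0 < y"
  shows "\<exists>!w. 0 < w \<and> w * exp w = y"
proof -
  have mono: "a * exp a < b * exp b" if "0 < a" "a < b" for a b :: real
    using that by (intro mult_strict_mono) auto
  have "\<exists>w\<ge>0. w \<le> y \<and> w * exp w = y"
  proof (rule IVT')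
    show "y \<le> y * exp y"
      using assms by simp
    show "continuous_on {0..y} (\<lambda>w. w * exp w)"
      by (intro continuous_intros)
  qed (use assms in auto)
  then obtain w where w: "0 \<le> w" "w * exp w = y"
    by blast
  with assms have "0 < w"
    by (cases "w = 0") auto
  show ?thesis
  proof (rule ex1I[of _ w])
    show "0 < w \<and> w * exp w = y"
      using \<open>0 < w\<close> w by simp
    show "v = w" if "0 < v \<and> v * exp v = y" for v
      using mono[of v w] mono[of w v] that \<open>0 < w\<close> w by (cases v w rule: linorder_cases) auto
  qed
qed

lemma lambert_W_pos: "0 < y \<Longrightarrow> 0 < lambert_W y"
  and lambert_W_times_exp: "0 < y \<Longrightarrow> lambert_W y * exp (lambert_W y) = y"
  using theI'[OF lambert_W_ex1] unfolding lambert_W_def by blast+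

end

theory Submission imports Defs begin

text \<open>
  Since \<open>x \<mapsto> (exp x - 1 - x) / x\<^sup>2\<close> is nondecreasing, a centred variable \<open>Y \<le> s\<close> of variance
  \<open>\<sigma>\<^sup>2\<close> has \<open>E[exp (\<lambda> Y)] \<le> 1 + \<sigma>\<^sup>2 / s\<^sup>2 * (exp (\<lambda> s) - 1 - \<lambda> s)\<close> for every \<open>\<lambda> > 0\<close>
  (Bennett), and the Chernoff bound gives the claim for every such \<open>\<lambda>\<close>. The Lambert value of \<open>\<lambda>\<close>,
  which is the minimiser of the right-hand side, enters only through its positivity: with
  \<open>a = s / t - 1\<close> and \<open>b = s\<^sup>2 / \<sigma>\<^sup>2\<close> one has \<open>\<lambda> s = a + b - W (a * exp (a + b))\<close>, and
  \<open>W (a * exp (a + b)) < a + b\<close> because \<open>a < a + b\<close>.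
\<close>

text \<open>The quadratic Taylor polynomials at \<open>x\<close> and \<open>- x\<close> multiply to
  \<open>1 + x^4 / 4\<close>, which is at least 1. The one at \<open>- x >= 0\<close> is below
  \<open>exp (- x)\<close>, so the one at \<open>x\<close> is at least
  \<open>1 / exp (- x)\<close>.\<close>

lemma exp_le_quadratic_of_nonpos:
  fixes x :: real
  assumes "x \<le> 0"
  shows "exp x \<le> 1 + x + x\<^sup>2 / 2"
proof -
  have "1 \<le> 1 + (x\<^sup>2)\<^sup>2 / 4"
    by simp
  also have "\<dots> = (1 + x + x\<^sup>2 / 2) * (1 + - x + (- x)\<^sup>2 / 2)"
    by (simp add: power2_eq_square field_simps)
  also have "\<dots> \<le> (1 + x + x\<^sup>2 / 2) * exp (- x)"
  proof (intro mult_left_mono exp_lower_Taylor_quadratic)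
    have "0 \<le> ((1 + x)\<^sup>2 + 1) / 2"
      by simp
    also have "\<dots> = 1 + x + x\<^sup>2 / 2"
      by (simp add: power2_eq_square field_simps)
    finally show "0 \<le> 1 + x + x\<^sup>2 / 2" .
  qed (use assms in simp)
  finally show ?thesis
    by (simp add: exp_minus field_simps)
qed

text \<open>
  The monotonicity of \<open>(exp x - 1 - x) / x\<^sup>2\<close>, without the division: power series termwise for
  \<open>x \<ge> 0\<close>, separation by the constant \<open>1 / 2\<close> for \<open>x < 0 < b\<close>.
\<close>

lemma exp_remainder_over_square_mono:
  fixes x b :: real
  assumes "x \<le> b" "0 < b"
  shows "b\<^sup>2 * (exp x - 1 - x) \<le> x\<^sup>2 * (exp b - 1 - b)"
proof (cases "x \<le> 0")
  case True
  have "b\<^sup>2 * (exp x - 1 - x) \<le> b\<^sup>2 * (x\<^sup>2 / 2)"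
    using exp_le_quadratic_of_nonpos[OF True] by (intro mult_left_mono) auto
  also have "\<dots> = x\<^sup>2 * (b\<^sup>2 / 2)"
    by simp
  also have "\<dots> \<le> x\<^sup>2 * (exp b - 1 - b)"
    using exp_lower_Taylor_quadratic[of b] assms by (intro mult_left_mono) auto
  finally show ?thesis .
next
  case False
  have sums: "(\<lambda>k. inverse (fact (k + 2)) * z ^ (k + 2)) sums (exp z - 1 - z)" for z :: real
  proof -
    have "summable (\<lambda>k. inverse (fact (k + 2)) * z ^ (k + 2))"
      using summable_exp[of z] by (rule summable_ignore_initial_segment)
    then show ?thesis
      using exp_first_two_terms[of z] by (simp add: sums_iff)
  qed
  show ?thesis
  proof (rule sums_le[OF _ sums_mult[OF sums] sums_mult[OF sums]])
    fix k
    \<comment> \<open>Both terms share the factor \<open>b^2 * x^2 / (k + 2)!\<close>, which leaves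
      \<open>x ^ k\<close> against \<open>b ^ k\<close>.\<close>
    have "b\<^sup>2 * (inverse (fact (k + 2)) * x ^ (k + 2))
        = (b\<^sup>2 * x\<^sup>2 * inverse (fact (k + 2))) * x ^ k"
      by (simp add: power_add power2_eq_square)
    also have "\<dots> \<le> (b\<^sup>2 * x\<^sup>2 * inverse (fact (k + 2))) * b ^ k"
      using False assms by (intro mult_left_mono power_mono) auto
    also have "\<dots> = x\<^sup>2 * (inverse (fact (k + 2)) * b ^ (k + 2))"
      by (simp add: power_add power2_eq_square)
    finally show "b\<^sup>2 * (inverse (fact (k + 2)) * x ^ (k + 2))
        \<le> x\<^sup>2 * (inverse (fact (k + 2)) * b ^ (k + 2))" .
  qed
qed

text \<open>Monotonicity at \<open>l * y\<close> and \<open>l * s\<close>, where \<open>l^2\<close>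
  cancels. The bound is quadratic in \<open>y\<close>, so its expectation depends only on the first
  two moments.\<close>

lemma exp_bound_Bennett:
  fixes l y s :: real
  assumes "0 < l" "0 < s" "y \<le> s"
  shows "exp (l * y) \<le> 1 + l * y + y\<^sup>2 / s\<^sup>2 * (exp (l * s) - 1 - l * s)"
proof -
  have "l\<^sup>2 * (s\<^sup>2 * (exp (l * y) - 1 - l * y)) \<le> l\<^sup>2 * (y\<^sup>2 * (exp (l * s) - 1 - l * s))"
    using exp_remainder_over_square_mono[of "l * y" "l * s"] assms
    by (simp add: power_mult_distrib mult.assoc)
  then have "s\<^sup>2 * (exp (l * y) - 1 - l * y) \<le> y\<^sup>2 * (exp (l * s) - 1 - l * s)"
    using assms by simp
  then show ?thesis
    using assms by (simp add: field_simps)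
qed

lemma lambert_W_less:
  assumes "0 < y" "0 < a" "y < a * exp a"
  shows "lambert_W y < a"
proof (rule ccontr)
  assume "\<not> lambert_W y < a"
  then have "a * exp a \<le> lambert_W y * exp (lambert_W y)"
    using assms by (intro mult_mono) auto
  then show False
    using assms by (simp add: lambert_W_times_exp)
qed

context prob_space
begin

lemma Bennett_mgf_bound:
  fixes Y :: "'a \<Rightarrow> real"
  assumes "integrable M Y" "expectation Y = 0"
    and "integrable M (\<lambda>x. (Y x)\<^sup>2)"
    and "AE x in M. Y x \<le> s" "0 < l" "0 < s"
  shows "integrable M (\<lambda>x. exp (l * Y x))"
    and "expectation (\<lambda>x. exp (l * Y x))
      \<le> expectation (\<lambda>x. (Y x)\<^sup>2) / s\<^sup>2 * (exp (l * s) - 1 - l * s) + 1"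
proof -
  note [measurable] = borel_measurable_integrable[OF assms(1)]
  show int: "integrable M (\<lambda>x. exp (l * Y x))"
  \<comment> \<open>\<open>Y\<close> may be unbounded below, but \<open>exp (l * Y x)\<close> lies
    almost surely between 0 and \<open>exp (l * s)\<close>.\<close>
  proof (rule integrable_const_bound)
    show "AE x in M. norm (exp (l * Y x)) \<le> exp (l * s)"
      using assms(4) by eventually_elim (use assms in simp)
  qed simp
  define c where "c = (exp (l * s) - 1 - l * s) / s\<^sup>2"
  have "expectation (\<lambda>x. exp (l * Y x)) \<le> expectation (\<lambda>x. 1 + l * Y x + (Y x)\<^sup>2 * c)"
  proof (rule integral_mono_AE[OF int])
    show "AE x in M. exp (l * Y x) \<le> 1 + l * Y x + (Y x)\<^sup>2 * c"
      using assms(4)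
    proof eventually_elim
      case (elim x)
      show ?case
        using exp_bound_Bennett[OF assms(5,6) elim] by (simp add: c_def)
    qed
  qed (use assms in auto)
  \<comment> \<open>The linear term vanishes because \<open>Y\<close> is centred.\<close>
  also have "\<dots> = 1 + expectation (\<lambda>x. (Y x)\<^sup>2) * c"
    using assms by (simp add: prob_space)
  finally show "expectation (\<lambda>x. exp (l * Y x))
      \<le> expectation (\<lambda>x. (Y x)\<^sup>2) / s\<^sup>2 * (exp (l * s) - 1 - l * s) + 1"
    by (simp add: c_def)
qed

text \<open>Markov's inequality for the exponential of the sum, whose expectation factorises by
  independence.\<close>

lemma Chernoff_sum_indep_vars:
  fixes Y :: "'i \<Rightarrow> 'a \<Rightarrow> real"
  assumes "finite I" "indep_vars (\<lambda>_. borel) Y I" "0 < l"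
    and "\<And>i. i \<in> I \<Longrightarrow> integrable M (\<lambda>x. exp (l * Y i x))"
    and "\<And>i. i \<in> I \<Longrightarrow> expectation (\<lambda>x. exp (l * Y i x)) \<le> B"
  shows "prob {x \<in> space M. a \<le> (\<Sum>i\<in>I. Y i x)} \<le> exp (- l * a) * B ^ card I"
proof -
  have ind: "indep_vars (\<lambda>_. borel) (\<lambda>i x. exp (l * Y i x)) I"
    by (rule indep_vars_compose2[OF assms(2)]) simp
  have prod: "exp (l * (\<Sum>i\<in>I. Y i x)) = (\<Prod>i\<in>I. exp (l * Y i x))" for x
    using assms(1) by (simp add: sum_distrib_left exp_sum)
  have int: "integrable M (\<lambda>x. exp (l * (\<Sum>i\<in>I. Y i x)))"
    unfolding prod by (rule indep_vars_integrable[OF assms(1) ind assms(4)])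
  have "prob {x \<in> space M. a \<le> (\<Sum>i\<in>I. Y i x)}
      \<le> exp (- l * a) * (\<integral>x\<in>space M. exp (l * (\<Sum>i\<in>I. Y i x)) \<partial>M)"
    using integrable_mult_indicator[OF sets.top int]
    by (intro Chernoff_ineq_ge[OF assms(3)]) (auto simp: set_integrable_def)
  also have "(\<integral>x\<in>space M. exp (l * (\<Sum>i\<in>I. Y i x)) \<partial>M) = (\<Prod>i\<in>I. expectation (\<lambda>x. exp (l * Y i x)))"
    using int indep_vars_lebesgue_integral[OF assms(1) ind assms(4)]
    by (simp add: set_integral_space prod)
  also have "\<dots> \<le> (\<Prod>i\<in>I. B)"
    by (intro prod_mono conjI assms(5) integral_nonneg_AE) auto
  finally show ?thesis
    by simp
qed

end

theorem theorem2p1: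
  fixes P :: "'a measure"
    and X :: "nat \<Rightarrow> 'a \<Rightarrow> real"
    and n :: nat
    and \<mu> M \<sigma> s t lam :: real
  assumes "prob_space P"
    and "n \<ge> 1"
    and "prob_space.indep_vars P (\<lambda>_. borel) X {1..n}"
    and "\<sigma> > 0"
    and "\<And>i. i \<in> {1..n} \<Longrightarrow> integrable P (X i)"
    and "\<And>i. i \<in> {1..n} \<Longrightarrow> integral\<^sup>L P (X i) = \<mu>"
    and "\<And>i. i \<in> {1..n} \<Longrightarrow> integrable P (\<lambda>\<omega>. (X i \<omega> - \<mu>)\<^sup>2)"
    and "\<And>i. i \<in> {1..n} \<Longrightarrow> integral\<^sup>L P (\<lambda>\<omega>. (X i \<omega> - \<mu>)\<^sup>2) = \<sigma>\<^sup>2"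
    and "\<And>i. i \<in> {1..n} \<Longrightarrow> measure P {\<omega> \<in> space P. X i \<omega> \<in> {..M}} = 1"
    and "s = M - \<mu>"
    and "t \<in> {0<..<M - \<mu>}"
    and "lam = 1 / t + s / \<sigma>\<^sup>2 - 1 / s
           - 1 / s * lambert_W (exp (s / t + s\<^sup>2 / \<sigma>\<^sup>2 - 1 + ln ((s - t) / t)))"
  shows "measure P {\<omega> \<in> space P.
             1 / real n * (\<Sum>i=1..n. X i \<omega>) - 1 / real n * (\<Sum>i=1..n. integral\<^sup>L P (X i)) \<ge> t}
           \<le> exp (- lam * real n * t) * (\<sigma>\<^sup>2 / s\<^sup>2 * (exp (lam * s) - 1 - lam * s) + 1) ^ n"
proof -
  interpret prob_space P by fact
  have t: "0 < t" "t < s" "0 < s"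
    using assms(10,11) by auto
  have lam: "0 < lam"
  proof -
    \<comment> \<open>This \<open>a\<close> is the sum \<open>a + b\<close> of the overview; the
      \<open>a\<close> of the overview is \<open>(s - t) / t\<close> here.\<close>
    define a where "a = s / t + s\<^sup>2 / \<sigma>\<^sup>2 - 1"
    have a: "(s - t) / t < a" "0 < (s - t) / t"
      using t assms(4) by (auto simp: a_def diff_divide_distrib)
    then have "exp (a + ln ((s - t) / t)) < a * exp a"
      by (simp only: exp_add exp_ln mult.commute[of a] mult_less_cancel_left_pos exp_gt_zero)
    then have "lambert_W (exp (a + ln ((s - t) / t))) < a"
      using a by (intro lambert_W_less) auto
    moreover have "lam * s = a - lambert_W (exp (a + ln ((s - t) / t)))"
      using t assms(4)
      by (simp add: assms(12) a_def left_diff_distrib distrib_right power2_eq_square)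
    ultimately have "0 < lam * s"
      by simp
    then show ?thesis
      using t by (simp add: zero_less_mult_iff)
  qed
  define Y where "Y = (\<lambda>i \<omega>. X i \<omega> - \<mu>)"
  \<comment> \<open>The subtracted mean equals \<mu>, so multiplying by \<open>n > 0\<close> turns
    the event into one about the sum of centred variables.\<close>
  have "{\<omega> \<in> space P. 1 / real n * (\<Sum>i=1..n. X i \<omega>)
        - 1 / real n * (\<Sum>i=1..n. integral\<^sup>L P (X i)) \<ge> t}
      = {\<omega> \<in> space P. real n * t \<le> (\<Sum>i\<in>{1..n}. Y i \<omega>)}"
    using assms(2,6) by (simp add: Y_def sum_subtractf field_simps)
  also have "prob \<dots> \<le> exp (- lam * (real n * t))
      * (\<sigma>\<^sup>2 / s\<^sup>2 * (exp (lam * s) - 1 - lam * s) + 1) ^ card {1..n}"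
  proof (rule Chernoff_sum_indep_vars[OF _ _ lam])
    show "indep_vars (\<lambda>_. borel) Y {1..n}"
      unfolding Y_def by (rule indep_vars_compose2[OF assms(3)]) simp
    fix i assume i: "i \<in> {1..n}"
    have le: "AE \<omega> in P. Y i \<omega> \<le> s"
      using AE_prob_1[OF assms(9)[OF i]] by eventually_elim (simp add: Y_def assms(10))
    have int: "integrable P (Y i)" and zero: "expectation (Y i) = 0"
      using assms(5,6)[OF i] by (simp_all add: Y_def prob_space)
    have sq: "integrable P (\<lambda>\<omega>. (Y i \<omega>)\<^sup>2)" "expectation (\<lambda>\<omega>. (Y i \<omega>)\<^sup>2) = \<sigma>\<^sup>2"
      using assms(7,8)[OF i] by (simp_all add: Y_def)
    note mgf = Bennett_mgf_bound[OF int zero sq(1) le lam t(3)]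
    show "integrable P (\<lambda>\<omega>. exp (lam * Y i \<omega>))"
      by (rule mgf(1))
    show "expectation (\<lambda>\<omega>. exp (lam * Y i \<omega>)) \<le> \<sigma>\<^sup>2 / s\<^sup>2 * (exp (lam * s) - 1 - lam * s) + 1"
      using mgf(2) by (simp add: sq(2))
  qed simp
  finally show ?thesis
    by (simp add: mult.assoc)
qed

end
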